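(* Let $G$ be a topological rough group such that $G$ (with the topology $\tau_G$) is Hausdorff and extremally disconnected. For any $g\in G$, if $gG=G$, then the set $M_g=\{x\in G: x^2=g\}$ is open and closed in $G$.
   Context: An approximation space $(X,R)$ is a non-empty set $X$ with an equivalence relation $R$; for $A\subset X$ the upper approximation is $\overline{A}=\{x\in X:[x]_R\cap A\neq\emptyset\}$, where $[x]_R$ is the equivalence class of $x$. Let $X$ carry a binary operation, written $xy$; $gG=\{gx:x\in G\}$. A subset $G\subset X$ is a rough group if: (1) $xy\in\overline{G}$ for all $x,y\in G$; (2) $(xy)z=x(yz)$ for all $x,y,z\in\overline{G}$; (3) there is $e\in\overline{G}$ (the rough identity element) with $ex=xe=x$ for all $x\in\overline{G}$; (4) for every $x\in G$ there is $y\in G$ with $xy=yx=e$ (written $y=x^{-1}$). A topological rough group is a rough group $G$ together with a topology $\tau$ on $\overline{G}$ such that, with $\tau_G$ the subspace topology on $G$, the multiplication $G\times G\to\overline{G}$, $(x,y)\mapsto xy$, is continuous (product topology of $\tau_G$ on $G\times G$, $\tau$ on $\overline{G}$) and the inverse mapping $G\to G$, $x\mapsto x^{-1}$, is continuous for $\tau_G$. A space is extremally disconnected if the closure of every open subset is open. *)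

theory Defs
  imports "HOL-Analysis.Analysis"
begin

definition upper_approx :: "'a set \<Rightarrow> ('a \<times> 'a) set \<Rightarrow> 'a set \<Rightarrow> 'a set" where
  "upper_approx X R A = {x \<in> X. R `` {x} \<inter> A \<noteq> {}}"

locale approximation_space =
  fixes X :: "'a set" and R :: "('a \<times> 'a) set"
  assumes nonempty: "X \<noteq> {}"
    and equiv: "equiv X R"

locale rough_group = approximation_space X R
  for X :: "'a set" and R :: "('a \<times> 'a) set" +
  fixes mult :: "'a \<Rightarrow> 'a \<Rightarrow> 'a" (infixl \<open>\<cdot>\<close> 70)
    and G :: "'a set"
  assumes mult_closed: "x \<in> X \<Longrightarrow> y \<in> X \<Longrightarrow> x \<cdot> y \<in> X"
    and subset: "G \<subseteq> X"
    and mult_upper: "x \<in> G \<Longrightarrow> y \<in> G \<Longrightarrow> x \<cdot> y \<in> upper_approx X R G"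
    and assoc: "x \<in> upper_approx X R G \<Longrightarrow> y \<in> upper_approx X R G \<Longrightarrow> z \<in> upper_approx X R G
      \<Longrightarrow> (x \<cdot> y) \<cdot> z = x \<cdot> (y \<cdot> z)"
    and identity_inverses:
      "\<exists>e \<in> upper_approx X R G. (\<forall>x \<in> upper_approx X R G. e \<cdot> x = x \<and> x \<cdot> e = x) \<and>
         (\<forall>x \<in> G. \<exists>y \<in> G. x \<cdot> y = e \<and> y \<cdot> x = e)"
begin

definition rough_identity :: 'a where
  "rough_identity = (THE e. e \<in> upper_approx X R G \<and>
     (\<forall>x \<in> upper_approx X R G. e \<cdot> x = x \<and> x \<cdot> e = x))"

definition rough_inverse :: "'a \<Rightarrow> 'a" where
  "rough_inverse x = (THE y. y \<in> G \<and> x \<cdot> y = rough_identity \<and> y \<cdot> x = rough_identity)"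

text \<open>The two definite descriptions above are well defined.\<close>

lemma subset_upper: "G \<subseteq> upper_approx X R G"
  using subset equiv by (auto simp: upper_approx_def dest: equiv_class_self)

lemma rough_identity_unique:
  assumes "e \<in> upper_approx X R G"
    and "\<And>x. x \<in> upper_approx X R G \<Longrightarrow> e \<cdot> x = x \<and> x \<cdot> e = x"
  shows "rough_identity = e"
  unfolding rough_identity_def
proof (rule the_equality)
  fix e' assume "e' \<in> upper_approx X R G \<and>
    (\<forall>x \<in> upper_approx X R G. e' \<cdot> x = x \<and> x \<cdot> e' = x)"
  then show "e' = e" using assms by metis
qed (use assms in blast)

lemma rough_identity:
  shows "rough_identity \<in> upper_approx X R G"
    and "x \<in> upper_approx X R G \<Longrightarrow> rough_identity \<cdot> x = x"
    and "x \<in> upper_approx X R G \<Longrightarrow> x \<cdot> rough_identity = x"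
  using identity_inverses rough_identity_unique by metis+

lemma inverse_exists:
  assumes "x \<in> G"
  shows "\<exists>y \<in> G. x \<cdot> y = rough_identity \<and> y \<cdot> x = rough_identity"
  using identity_inverses rough_identity_unique assms by metis

lemma rough_inverse_unique:
  assumes "x \<in> G" "y \<in> G" "x \<cdot> y = rough_identity" "y \<cdot> x = rough_identity"
  shows "rough_inverse x = y"
  unfolding rough_inverse_def
proof (rule the_equality)
  fix z assume z: "z \<in> G \<and> x \<cdot> z = rough_identity \<and> z \<cdot> x = rough_identity"
  have "z = z \<cdot> (x \<cdot> y)"
    using z assms rough_identity(3) subset_upper by auto
  also have "\<dots> = (z \<cdot> x) \<cdot> y"
    using assoc[of z x y] z assms(1,2) subset_upper by (metis subsetD)
  also have "\<dots> = y"
    using z assms rough_identity(2) subset_upper by auto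
  finally show "z = y" .
qed (use assms in blast)

lemma rough_inverse:
  assumes "x \<in> G"
  shows "rough_inverse x \<in> G"
    and "x \<cdot> rough_inverse x = rough_identity"
    and "rough_inverse x \<cdot> x = rough_identity"
  using inverse_exists[OF assms] rough_inverse_unique[OF assms] by auto

end

text \<open>The topology lives on the upper approximation of \<open>G\<close>; the space \<open>G\<close> itself always
  carries \<open>subtopology T G\<close>.\<close>

locale topological_rough_group = rough_group X R mult G
  for X :: "'a set" and R :: "('a \<times> 'a) set" and mult :: "'a \<Rightarrow> 'a \<Rightarrow> 'a" (infixl \<open>\<cdot>\<close> 70)
    and G :: "'a set" +
  fixes T :: "'a topology"
  assumes topspace_eq: "topspace T = upper_approx X R G"
    and continuous_mult:
      "continuous_map (prod_topology (subtopology T G) (subtopology T G)) T (\<lambda>(x, y). x \<cdot> y)"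
    and continuous_inverse:
      "continuous_map (subtopology T G) (subtopology T G) rough_inverse"

definition extremally_disconnected_space :: "'a topology \<Rightarrow> bool" where
  "extremally_disconnected_space T \<longleftrightarrow> (\<forall>U. openin T U \<longrightarrow> openin T (T closure_of U))"

end

theory Submission
  imports Defs
begin

text \<open>
  Since \<open>x\<^sup>2 = g\<close> exactly when \<open>g x\<inverse> = x\<close>, the set in question is the fixed point set of
  \<open>x \<mapsto> g x\<inverse>\<close>, which is a homeomorphism of \<open>G\<close> because \<open>g G = G\<close>. The fixed point set of a
  homeomorphism \<open>f\<close> of an extremally disconnected Hausdorff space is clopen (Frolik): a maximal
  open \<open>U\<close> with \<open>U \<inter> f(U) = \<emptyset>\<close> is clopen, and the points that \<open>f\<close> moves are exactly those of
  \<open>U \<union> f(U) \<union> f\<inverse>(U)\<close>.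
\<close>

text \<open>An open set that misses a set also misses its closure. This is applied twice: first to
  \<open>U\<close> against \<open>V\<close>, then to the closure of \<open>V\<close>, which is
  itself open here, against \<open>U\<close>.\<close>

lemma extremally_disconnected_disjoint_closures:
  assumes "extremally_disconnected_space S" "openin S U" "openin S V" "U \<inter> V = {}"
  shows "S closure_of U \<inter> S closure_of V = {}"
proof -
  have "U \<inter> S closure_of V = {}"
    using assms openin_Int_closure_of_eq_empty by metis
  moreover have "openin S (S closure_of V)"
    using assms by (simp add: extremally_disconnected_space_def)
  ultimately show ?thesis
    using openin_Int_closure_of_eq_empty by (metis Int_commute)
qed

text \<open>Separate \<open>x\<close> from \<open>f x\<close> and cut the neighbourhood of
  \<open>x\<close> down to the points that \<open>f\<close> sends into the neighbourhood of
  \<open>f x\<close>.\<close>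

lemma Hausdorff_space_moved_point_nhd:
  assumes "Hausdorff_space S" "continuous_map S S f" "x \<in> topspace S" "f x \<noteq> x"
  obtains V where "openin S V" "x \<in> V" "V \<inter> f ` V = {}"
proof -
  have "f x \<in> topspace S"
    using assms continuous_map_image_subset_topspace by blast
  then obtain A B where AB: "openin S A" "openin S B" "x \<in> A" "f x \<in> B" "disjnt A B"
    using assms unfolding Hausdorff_space_def by metis
  define V where "V = A \<inter> {y \<in> topspace S. f y \<in> B}"
  show thesis
  proof
    show "openin S V"
      unfolding V_def
      using AB(1,2) assms(2) by (intro openin_Int openin_continuous_map_preimage)
    show "x \<in> V" "V \<inter> f ` V = {}"
      using AB assms(3) by (auto simp: V_def disjnt_iff)
  qed
qed

lemma maximal_open_moved_off_itself:
  obtains U where "openin S U" "U \<inter> f ` U = {}"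
    "\<And>W. openin S W \<Longrightarrow> W \<inter> f ` W = {} \<Longrightarrow> U \<subseteq> W \<Longrightarrow> W = U"
proof -
  define \<A> where "\<A> = {U. openin S U \<and> U \<inter> f ` U = {}}"
  have "\<exists>M\<in>\<A>. \<forall>W\<in>\<A>. M \<subseteq> W \<longrightarrow> W = M"
  proof (rule subset_Zorn_nonempty)
    have "{} \<in> \<A>"
      by (simp add: \<A>_def)
    then show "\<A> \<noteq> {}"
      by blast
  next
    fix \<C> assume "\<C> \<noteq> {}" and chain: "subset.chain \<A> \<C>"
    have \<C>: "openin S A" "A \<inter> f ` A = {}" if "A \<in> \<C>" for A
      using that chain by (auto simp: subset_chain_def \<A>_def)
    have "A \<inter> f ` B = {}" if "A \<in> \<C>" "B \<in> \<C>" for A B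
    proof -
      have "A \<subseteq> B \<or> B \<subseteq> A"
        using that chain by (auto simp: subset_chain_def)
      then show ?thesis
      proof
        assume "A \<subseteq> B"
        then show ?thesis
          using \<C>(2)[OF that(2)] by blast
      next
        assume "B \<subseteq> A"
        then have "f ` B \<subseteq> f ` A"
          by (rule image_mono)
        then show ?thesis
          using \<C>(2)[OF that(1)] by blast
      qed
    qed
    then have "\<Union>\<C> \<inter> f ` \<Union>\<C> = {}"
      unfolding image_Union by blast
    then show "\<Union>\<C> \<in> \<A>"
      using \<C>(1) by (auto simp: \<A>_def)
  qed
  then obtain M where "M \<in> \<A>" and max: "\<And>W. W \<in> \<A> \<Longrightarrow> M \<subseteq> W \<Longrightarrow> W = M"
    by blast
  then show thesis
    using that[of M] by (simp add: \<A>_def)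
qed

theorem clopen_fixed_points_extremally_disconnected:
  assumes "Hausdorff_space S" "extremally_disconnected_space S" "homeomorphic_map S S f"
  shows "openin S {x \<in> topspace S. f x = x}" "closedin S {x \<in> topspace S. f x = x}"
proof -
  have cont: "continuous_map S S f"
    using assms(3) homeomorphic_imp_continuous_map by blast
  obtain U where U: "openin S U" "U \<inter> f ` U = {}"
    and max: "\<And>W. openin S W \<Longrightarrow> W \<inter> f ` W = {} \<Longrightarrow> U \<subseteq> W \<Longrightarrow> W = U"
    using maximal_open_moved_off_itself by blast
  have sub: "U \<subseteq> topspace S"
    using U(1) openin_subset by blast
  have fU: "openin S (f ` U)"
    using homeomorphic_map_openness[OF assms(3) sub] U(1) by simp
  have "closedin S U"
  proof -
    \<comment> \<open>As \<open>f\<close> commutes with closure, the closure of \<open>U\<close> is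
      again an open set disjoint from its image, so maximality of \<open>U\<close> forces it to
      equal \<open>U\<close>.\<close>
    have "f ` (S closure_of U) = S closure_of (f ` U)"
      using homeomorphic_map_closure_of[OF assms(3) sub] by simp
    then have "S closure_of U \<inter> f ` (S closure_of U) = {}"
      using extremally_disconnected_disjoint_closures[OF assms(2) U(1) fU U(2)] by simp
    moreover have "openin S (S closure_of U)"
      using assms(2) U(1) by (simp add: extremally_disconnected_space_def)
    ultimately have "S closure_of U = U"
      using max[of "S closure_of U"] closure_of_subset[OF sub] by simp
    then show ?thesis
      by (metis closedin_closure_of)
  qed
  then have fU': "closedin S (f ` U)"
    using homeomorphic_map_closedness[OF assms(3) sub] by simp
  define P where "P = {x \<in> topspace S. f x \<in> U}"
  define M where "M = U \<union> f ` U \<union> P"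
  have "openin S P" "closedin S P"
    unfolding P_def using cont U(1) \<open>closedin S U\<close>
    by (auto intro: openin_continuous_map_preimage closedin_continuous_map_preimage)
  then have M: "openin S M" "closedin S M"
    unfolding M_def using U(1) \<open>closedin S U\<close> fU fU' by auto
  \<comment> \<open>A fixed point in \<open>P\<close> lies in \<open>U\<close> by definition of
    \<open>P\<close>, one in \<open>f\<close>
    U\<open>by injectivity; but a fixed point in\<close>U\<open>would also lie in\<close>f
    \<open>U\<close>.\<close>
  have "f x \<noteq> x" if "x \<in> M" for x
  proof
    assume "f x = x"
    have inj: "inj_on f (topspace S)"
      using assms(3) homeomorphic_imp_injective_map by blast
    have "x \<in> topspace S"
      using that M(1) openin_subset by blast
    then have "x \<in> U" if "x \<in> f ` U"
      using that \<open>f x = x\<close> sub inj by (metis imageE inj_onD subsetD)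
    moreover have "x \<in> U" if "x \<in> P"
      using that \<open>f x = x\<close> by (simp add: P_def)
    ultimately have "x \<in> U"
      using that by (auto simp: M_def)
    then show False
      using U(2) \<open>f x = x\<close> by (metis disjoint_iff imageI)
  qed
  moreover have "f x = x" if x: "x \<in> topspace S - M" for x
  proof (rule ccontr)
    assume "f x \<noteq> x"
    then obtain V where V: "openin S V" "x \<in> V" "V \<inter> f ` V = {}"
      using Hausdorff_space_moved_point_nhd[OF assms(1) cont] x by blast
    define W where "W = V - M"
    have W: "openin S W" "x \<in> W" "W \<inter> M = {}"
      unfolding W_def using V(1,2) x M(2) by auto
    have "W \<inter> f ` W = {}"
      using V(3) unfolding W_def by blast
    moreover have "U \<inter> f ` W = {}"
    proof -
      have "W \<inter> P = {}" "W \<subseteq> topspace S"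
        using W(3) openin_subset[OF W(1)] by (auto simp: M_def)
      then show ?thesis
        unfolding P_def by blast
    qed
    moreover have "W \<inter> f ` U = {}"
      using W(3) unfolding M_def by blast
    ultimately have "(U \<union> W) \<inter> f ` (U \<union> W) = {}"
      using U(2) by (simp add: image_Un Int_Un_distrib Int_Un_distrib2)
    then have "U \<union> W = U"
      using max[OF openin_Un[OF U(1) W(1)]] by simp
    then show False
      using W(2,3) by (auto simp: M_def)
  qed
  ultimately have "{x \<in> topspace S. f x = x} = topspace S - M"
    by auto
  then show "openin S {x \<in> topspace S. f x = x}" "closedin S {x \<in> topspace S. f x = x}"
    using M by auto
qed

context rough_group
begin

lemma mem_upper: "x \<in> G \<Longrightarrow> x \<in> upper_approx X R G"
  using subset_upper by blast

lemma rough_inverse_involution: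
  assumes "x \<in> G"
  shows "rough_inverse (rough_inverse x) = x"
  by (rule rough_inverse_unique) (simp_all add: rough_inverse assms)

text \<open>The inner products may leave \<open>G\<close>, but associativity is applied only to
  triples of elements of \<open>G\<close>, all of which lie in the upper approximation.\<close>

lemma mult_inverse_cancel_left:
  assumes "g \<in> G" "x \<in> G"
  shows "rough_inverse g \<cdot> (g \<cdot> x) = x" "g \<cdot> (rough_inverse g \<cdot> x) = x"
  by (simp_all add: assoc[symmetric] rough_inverse rough_identity mem_upper assms)

text \<open>Multiply on the right by the inverse of \<open>x\<close>, respectively by
  \<open>x\<close>.\<close>

lemma square_eq_iff_fixed:
  assumes "g \<in> G" "x \<in> G"
  shows "x \<cdot> x = g \<longleftrightarrow> g \<cdot> rough_inverse x = x"
proof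
  assume g: "x \<cdot> x = g"
  have "(x \<cdot> x) \<cdot> rough_inverse x = x"
    by (simp add: assoc rough_inverse rough_identity mem_upper assms)
  then show "g \<cdot> rough_inverse x = x"
    by (simp only: g)
next
  assume x: "g \<cdot> rough_inverse x = x"
  have "(g \<cdot> rough_inverse x) \<cdot> x = g"
    by (simp add: assoc rough_inverse rough_identity mem_upper assms)
  then show "x \<cdot> x = g"
    by (simp only: x)
qed

end

context topological_rough_group
begin

lemma topspace_subtopology_G: "topspace (subtopology T G) = G"
  using topspace_eq subset_upper by auto

text \<open>Restricting the jointly continuous product to the slice with first factor
  \<open>a\<close> gives a map into the upper approximation; the inclusion assumption lets its
  codomain shrink to \<open>G\<close>.\<close>

lemma continuous_map_translation:
  assumes "a \<in> G" "(\<cdot>) a ` G \<subseteq> G"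
  shows "continuous_map (subtopology T G) (subtopology T G) ((\<cdot>) a)"
proof -
  have "continuous_map (subtopology T G) (prod_topology (subtopology T G) (subtopology T G))
    (\<lambda>x. (a, x))"
    using assms topspace_subtopology_G
    by (intro continuous_map_pairedI continuous_map_const[THEN iffD2] continuous_map_id[unfolded id_def]) auto
  from continuous_map_compose[OF this continuous_mult]
  have "continuous_map (subtopology T G) T ((\<cdot>) a)"
    by (simp add: o_def)
  then show ?thesis
    using assms(2) topspace_subtopology_G by (auto simp: continuous_map_in_subtopology)
qed

lemma homeomorphic_map_mult_inverse:
  assumes "g \<in> G" "(\<cdot>) g ` G = G"
  shows "homeomorphic_map (subtopology T G) (subtopology T G) (\<lambda>x. g \<cdot> rough_inverse x)"
proof -
  \<comment> \<open>Surjectivity in \<open>g G = G\<close> is what keeps translation by the inverse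
    of \<open>g\<close> inside \<open>G\<close>.\<close>
  have "rough_inverse g \<cdot> y \<in> G" if "y \<in> G" for y
  proof -
    obtain x where "x \<in> G" "y = g \<cdot> x"
      using assms(2) \<open>y \<in> G\<close> by blast
    then show ?thesis
      using mult_inverse_cancel_left(1) assms(1) by simp
  qed
  then have translation: "continuous_map (subtopology T G) (subtopology T G) ((\<cdot>) (rough_inverse g))"
    using rough_inverse(1) assms(1) by (intro continuous_map_translation) auto
  \<comment> \<open>The inverse map comes from solving \<open>y = g \<cdot> rough_inverse x\<close>
    for \<open>x\<close>. Both maps are composites of a translation and the inversion.\<close>
  have "homeomorphic_maps (subtopology T G) (subtopology T G)
    (\<lambda>x. g \<cdot> rough_inverse x) (\<lambda>y. rough_inverse (rough_inverse g \<cdot> y))"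
    unfolding homeomorphic_maps_def topspace_subtopology_G
  proof (intro conjI ballI)
    show "continuous_map (subtopology T G) (subtopology T G) (\<lambda>x. g \<cdot> rough_inverse x)"
      using continuous_map_compose[OF continuous_inverse continuous_map_translation] assms
      by (simp add: o_def)
    show "continuous_map (subtopology T G) (subtopology T G)
      (\<lambda>y. rough_inverse (rough_inverse g \<cdot> y))"
      using continuous_map_compose[OF translation continuous_inverse] by (simp add: o_def)
  next
    fix x assume "x \<in> G"
    then show "rough_inverse (rough_inverse g \<cdot> (g \<cdot> rough_inverse x)) = x"
      using mult_inverse_cancel_left(1) rough_inverse_involution rough_inverse(1) assms(1) by simp
  next
    fix y assume "y \<in> G"
    then show "g \<cdot> rough_inverse (rough_inverse (rough_inverse g \<cdot> y)) = y"
      using mult_inverse_cancel_left(2) rough_inverse_involution assms(1)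
        \<open>\<And>y. y \<in> G \<Longrightarrow> rough_inverse g \<cdot> y \<in> G\<close> by simp
  qed
  then show ?thesis
    by (rule homeomorphic_maps_imp_map)
qed

end

theorem theorem4p19:
  fixes X :: "'a set" and R :: "('a \<times> 'a) set" and mult :: "'a \<Rightarrow> 'a \<Rightarrow> 'a"
    and G :: "'a set" and T :: "'a topology" and g :: 'a
  assumes "topological_rough_group X R mult G T"
    and "Hausdorff_space (subtopology T G)"
    and "extremally_disconnected_space (subtopology T G)"
    and "g \<in> G"
    and "(\<lambda>x. mult g x) ` G = G"
  shows "openin (subtopology T G) {x \<in> G. mult x x = g} \<and>
    closedin (subtopology T G) {x \<in> G. mult x x = g}"
proof -
  interpret topological_rough_group X R mult G T
    by fact
  have "{x \<in> G. mult x x = g} =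
    {x \<in> topspace (subtopology T G). mult g (rough_inverse x) = x}"
    unfolding topspace_subtopology_G using square_eq_iff_fixed assms(4) by blast
  then show ?thesis
    using clopen_fixed_points_extremally_disconnected[OF assms(2,3)
        homeomorphic_map_mult_inverse[OF assms(4,5)]] by simp
qed

end
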